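(* Let $G$ be a finite group, let $\mathcal{T}=(G,A,B)$ be a triple factorisation, and let $N$ be a normal subgroup of $G$. If $N\leq \mathrm{core}_G(A)\,\mathrm{core}_G(B)$, then $\mathcal{T}$ is nondegenerate if and only if $\mathcal{T}/N$ is nondegenerate.
   Context: A triple factorisation $\mathcal{T}=(G,A,B)$ consists of a finite group $G$ and subgroups $A,B\leq G$ with $G=ABA$. It is degenerate if $G=AB$ and nondegenerate if $G\neq AB$. For $H\leq G$, $\mathrm{core}_G(H)=\bigcap_{g\in G}H^g$. For a normal subgroup $N$ of $G$, the quotient of $\mathcal{T}$ modulo $N$ is $\mathcal{T}/N=(G/N,AN/N,BN/N)$, which is again a triple factorisation. *)

theory Defs
  imports "HOL-Algebra.Coset"
begin

locale triple_factorisation = group G for G (structure) +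
  fixes A B
  assumes finite_carrier: "finite (carrier G)"
    and subgroup_A: "subgroup A G"
    and subgroup_B: "subgroup B G"
    and factorisation: "carrier G = A <#> B <#> A"

definition degenerate :: "('a, 'b) monoid_scheme \<Rightarrow> 'a set \<Rightarrow> 'a set \<Rightarrow> bool" where
  "degenerate G A B \<longleftrightarrow> triple_factorisation G A B \<and> carrier G = A <#>\<^bsub>G\<^esub> B"

definition nondegenerate :: "('a, 'b) monoid_scheme \<Rightarrow> 'a set \<Rightarrow> 'a set \<Rightarrow> bool" where
  "nondegenerate G A B \<longleftrightarrow> triple_factorisation G A B \<and> carrier G \<noteq> A <#>\<^bsub>G\<^esub> B"

(* H^g = g^(-1) H g *)
definition conj_set :: "('a, 'b) monoid_scheme \<Rightarrow> 'a set \<Rightarrow> 'a \<Rightarrow> 'a set" where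
  "conj_set G H g = inv\<^bsub>G\<^esub> g <#\<^bsub>G\<^esub> H #>\<^bsub>G\<^esub> g"

definition core :: "('a, 'b) monoid_scheme \<Rightarrow> 'a set \<Rightarrow> 'a set" where
  "core G H = (\<Inter>g\<in>carrier G. conj_set G H g)"

(* HN/N as a subset of G/N: the set of N-cosets of the elements of HN. *)
definition quot_image :: "('a, 'b) monoid_scheme \<Rightarrow> 'a set \<Rightarrow> 'a set \<Rightarrow> 'a set set" where
  "quot_image G N H = carrier (G\<lparr>carrier := H <#>\<^bsub>G\<^esub> N\<rparr> Mod N)"

end

theory Submission
  imports Defs
begin

text \<open>
  Write \<open>\<pi>\<close> for the projection \<open>x \<mapsto> N #> x\<close> of \<open>G\<close> onto \<open>G Mod N\<close>. The quotient of
  \<open>(G, A, B)\<close> modulo \<open>N\<close> consists of the images of \<open>G\<close>, \<open>A\<close> and \<open>B\<close> under \<open>\<pi>\<close>, so it is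
  again a triple factorisation, and \<open>G = AB\<close> implies that the quotient is degenerate.
  Conversely, if \<open>\<pi>\<close> maps \<open>AB\<close> onto \<open>G Mod N\<close>, then every element of \<open>G\<close> is \<open>abn\<close> with
  \<open>n \<in> N\<close>, and it remains to absorb \<open>n\<close>, that is, to see \<open>ABN \<subseteq> AB\<close>. Decompose \<open>n = kl\<close>
  with \<open>k\<close> in the core of \<open>A\<close> and \<open>l\<close> in the core of \<open>B\<close>; then
  \<open>abn = a (b k b\<inverse>) \<cdot> (b l)\<close>, where \<open>b k b\<inverse>\<close> lies in \<open>A\<close> because \<open>k\<close> lies in
  \<open>b\<inverse> A b\<close>. This is lemma \<open>mult_core_mult_in_set_mult\<close>.
\<close>

lemma (in group) core_memE:
  assumes "k \<in> core G H" "g \<in> carrier G"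
  obtains h where "h \<in> H" "k = inv g \<otimes> h \<otimes> g"
proof -
  have "k \<in> inv g <# H #> g"
    using assms by (auto simp: core_def conj_set_def)
  then show thesis
    using that by (auto simp: l_coset_def r_coset_def)
qed

lemma (in group) core_conj_mem:
  assumes "H \<subseteq> carrier G" "k \<in> core G H" "g \<in> carrier G"
  shows "g \<otimes> k \<otimes> inv g \<in> H"
proof -
  obtain h where h: "h \<in> H" "k = inv g \<otimes> h \<otimes> g"
    using assms(2,3) by (rule core_memE)
  have hc: "h \<in> carrier G" using h(1) assms(1) by blast
  have "g \<otimes> (inv g \<otimes> h) = h"
    using hc assms(3) by (simp flip: m_assoc)
  then have "g \<otimes> (inv g \<otimes> h \<otimes> g) \<otimes> inv g = h"
    using hc assms(3) by (simp add: m_assoc)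
  then show ?thesis using h by simp
qed

lemma (in group) core_subset:
  assumes "H \<subseteq> carrier G"
  shows "core G H \<subseteq> H"
proof
  fix k assume "k \<in> core G H"
  then obtain h where h: "h \<in> H" "k = inv \<one> \<otimes> h \<otimes> \<one>"
    using one_closed by (rule core_memE)
  moreover have "h \<in> carrier G" using h(1) assms by blast
  ultimately show "k \<in> H" by simp
qed

text \<open>
  The core of \<open>A\<close> can be moved to the left past any element \<open>b\<close>, because the conjugate
  by \<open>b\<close> of a core element still lies in \<open>A\<close>.
\<close>
lemma (in group) mult_core_mult_in_set_mult:
  assumes A: "subgroup A G" and B: "subgroup B G"
    and x: "x \<in> A <#> B" and n: "n \<in> core G A <#> core G B"
  shows "x \<otimes> n \<in> A <#> B"
proof -
  obtain a b where ab: "a \<in> A" "b \<in> B" "x = a \<otimes> b"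
    using x unfolding set_mult_def by blast
  obtain k l where kl: "k \<in> core G A" "l \<in> core G B" "n = k \<otimes> l"
    using n unfolding set_mult_def by blast
  have sub: "A \<subseteq> carrier G" "B \<subseteq> carrier G"
    using A B by (auto dest: subgroup.subset)
  have mem: "k \<in> A" "l \<in> B"
    using kl core_subset sub by blast+
  have carr: "a \<in> carrier G" "b \<in> carrier G" "k \<in> carrier G" "l \<in> carrier G"
    using ab mem sub by blast+
  have "a \<otimes> (b \<otimes> k \<otimes> inv b) \<in> A"
    using A ab(1) core_conj_mem[OF sub(1) kl(1) carr(2)] by (rule subgroup.m_closed)
  moreover have "b \<otimes> l \<in> B"
    using B ab(2) mem(2) by (rule subgroup.m_closed)
  moreover have "x \<otimes> n = (a \<otimes> (b \<otimes> k \<otimes> inv b)) \<otimes> (b \<otimes> l)"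
  proof -
    have "inv b \<otimes> (b \<otimes> l) = l" using carr by (simp flip: m_assoc)
    then show ?thesis unfolding ab(3) kl(3) using carr by (simp add: m_assoc)
  qed
  ultimately show ?thesis unfolding set_mult_def by blast
qed

text \<open>
  Passing from \<open>KH\<close> to \<open>K\<close> loses no coset, since \<open>Hkh = khH = kH = Hk\<close>. In this form
  the quotient is the image under a homomorphism, to which general facts about images apply.
\<close>
lemma (in normal) quot_image_eq_image:
  assumes "K \<subseteq> carrier G"
  shows "quot_image G H K = (\<lambda>x. H #> x) ` K"
proof -
  have quot_image: "quot_image G H K = (\<lambda>x. H #> x) ` (K <#> H)"
    unfolding quot_image_def FactGroup_def RCOSETS_def r_coset_def by auto
  have absorb: "H #> (k \<otimes> h) = H #> k" if "k \<in> K" "h \<in> H" for k h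
  proof -
    have k: "k \<in> carrier G" using that assms by blast
    have "k \<otimes> h \<in> k <# H" using that unfolding l_coset_def by blast
    then have "k \<otimes> h \<in> H #> k" using coset_eq k by simp
    then show ?thesis using k repr_independence is_subgroup by metis
  qed
  show ?thesis
  proof
    show "quot_image G H K \<subseteq> (\<lambda>x. H #> x) ` K"
      unfolding quot_image using absorb by (auto simp: set_mult_def)
    show "(\<lambda>x. H #> x) ` K \<subseteq> quot_image G H K"
    proof
      fix X assume "X \<in> (\<lambda>x. H #> x) ` K"
      then obtain k where k: "k \<in> K" "X = H #> k" by blast
      have "k = k \<otimes> \<one>" using assms k(1) by auto
      then have "k \<in> K <#> H"
        using k(1) subgroup.one_closed[OF is_subgroup] unfolding set_mult_def by blast
      then show "X \<in> quot_image G H K" unfolding quot_image using k(2) by blast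
    qed
  qed
qed

lemma (in group_hom) image_set_mult:
  assumes "K \<subseteq> carrier G" "L \<subseteq> carrier G"
  shows "h ` (K <#>\<^bsub>G\<^esub> L) = (h ` K) <#>\<^bsub>H\<^esub> (h ` L)"
proof -
  have "h (k \<otimes>\<^bsub>G\<^esub> l) = h k \<otimes>\<^bsub>H\<^esub> h l" if "k \<in> K" "l \<in> L" for k l
    using that assms by (simp add: subset_iff)
  then have "(\<lambda>(k, l). h (k \<otimes>\<^bsub>G\<^esub> l)) ` (K \<times> L) = (\<lambda>(k, l). h k \<otimes>\<^bsub>H\<^esub> h l) ` (K \<times> L)"
    by (intro image_cong) auto
  moreover have "h ` (K <#>\<^bsub>G\<^esub> L) = (\<lambda>(k, l). h (k \<otimes>\<^bsub>G\<^esub> l)) ` (K \<times> L)"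
    unfolding set_mult_def by force
  moreover have "h ` K <#>\<^bsub>H\<^esub> h ` L = (\<lambda>(k, l). h k \<otimes>\<^bsub>H\<^esub> h l) ` (K \<times> L)"
    unfolding set_mult_def by force
  ultimately show ?thesis by simp
qed

lemma (in group_hom) triple_factorisation_image:
  assumes tf: "triple_factorisation G A B" and surj: "h ` carrier G = carrier H"
  shows "triple_factorisation H (h ` A) (h ` B)"
proof -
  interpret tf: triple_factorisation G A B by (rule tf)
  have sub: "A \<subseteq> carrier G" "B \<subseteq> carrier G"
    using tf.subgroup_A tf.subgroup_B by (auto dest: subgroup.subset)
  show ?thesis
  proof (intro triple_factorisation.intro triple_factorisation_axioms.intro)
    show "group H" by (rule H.is_group)
    show "finite (carrier H)"
      using tf.finite_carrier surj by (metis finite_imageI)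
    show "subgroup (h ` A) H" "subgroup (h ` B) H"
      using tf.subgroup_A tf.subgroup_B by (simp_all add: subgroup_img_is_subgroup)
    have "carrier H = h ` (A <#>\<^bsub>G\<^esub> B <#>\<^bsub>G\<^esub> A)"
      using tf.factorisation surj by argo
    then show "carrier H = h ` A <#>\<^bsub>H\<^esub> h ` B <#>\<^bsub>H\<^esub> h ` A"
      using sub by (simp add: image_set_mult G.set_mult_closed)
  qed
qed

theorem mainTheorem2:
  fixes G :: "('a, 'b) monoid_scheme" and A B N :: "'a set"
  assumes "triple_factorisation G A B"
    and "N \<lhd> G"
    and "N \<subseteq> core G A <#>\<^bsub>G\<^esub> core G B"
  shows "nondegenerate G A B \<longleftrightarrow>
    nondegenerate (G Mod N) (quot_image G N A) (quot_image G N B)"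
proof -
  interpret tf: triple_factorisation G A B by (rule assms(1))
  interpret N: normal N G by (rule assms(2))
  let ?\<pi> = "\<lambda>x. N #>\<^bsub>G\<^esub> x"
  interpret \<pi>: group_hom G "G Mod N" ?\<pi>
    using N.r_coset_hom_Mod N.factorgroup_is_group
    by (intro group_hom.intro group_hom_axioms.intro tf.is_group)
  have sub: "A \<subseteq> carrier G" "B \<subseteq> carrier G"
    using tf.subgroup_A tf.subgroup_B by (auto dest: subgroup.subset)
  have AB_sub: "A <#>\<^bsub>G\<^esub> B \<subseteq> carrier G"
    using sub by (rule tf.set_mult_closed)
  have surj: "?\<pi> ` carrier G = carrier (G Mod N)"
    unfolding FactGroup_def RCOSETS_def by auto
  have quot_tf: "triple_factorisation (G Mod N) (?\<pi> ` A) (?\<pi> ` B)"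
    using assms(1) surj by (rule \<pi>.triple_factorisation_image)
  have full_if_image_full: "carrier G = A <#>\<^bsub>G\<^esub> B"
    if img: "?\<pi> ` carrier G = ?\<pi> ` (A <#>\<^bsub>G\<^esub> B)"
  proof
    show "carrier G \<subseteq> A <#>\<^bsub>G\<^esub> B"
    proof
      fix g assume g: "g \<in> carrier G"
      then obtain x where x: "x \<in> A <#>\<^bsub>G\<^esub> B" "?\<pi> g = ?\<pi> x" using img by blast
      have xc: "x \<in> carrier G" using x(1) AB_sub by blast
      have "g \<in> N #>\<^bsub>G\<^esub> x"
        using tf.rcos_self[OF g N.is_subgroup] x(2) by simp
      \<comment> \<open>normality puts the factor from \<open>N\<close> on the right, where it can be absorbed\<close>
      then have "g \<in> x <#\<^bsub>G\<^esub> N" using N.coset_eq xc by simp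
      then obtain n where n: "n \<in> N" "g = x \<otimes>\<^bsub>G\<^esub> n" unfolding l_coset_def by blast
      have "n \<in> core G A <#>\<^bsub>G\<^esub> core G B" using n(1) assms(3) by blast
      with x(1) show "g \<in> A <#>\<^bsub>G\<^esub> B" unfolding n(2)
        by (rule tf.mult_core_mult_in_set_mult[OF tf.subgroup_A tf.subgroup_B])
    qed
  qed (rule AB_sub)
  have "carrier (G Mod N) = ?\<pi> ` A <#>\<^bsub>G Mod N\<^esub> ?\<pi> ` B \<longleftrightarrow> carrier G = A <#>\<^bsub>G\<^esub> B"
    unfolding \<pi>.image_set_mult[OF sub, symmetric] surj[symmetric]
    using full_if_image_full by metis
  then show ?thesis
    unfolding nondegenerate_def N.quot_image_eq_image[OF sub(1)] N.quot_image_eq_image[OF sub(2)]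
    using assms(1) quot_tf by blast
qed

end
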